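(* Let $S_1$ and $S_2$ be numerical monoids. The reduced finitary power monoids $\mathcal P_{\mathrm{fin},0}(S_1)$ and $\mathcal P_{\mathrm{fin},0}(S_2)$ are isomorphic (as monoids) if and only if $S_1 = S_2$.
   Context: A numerical monoid is a submonoid $S$ of the additive monoid $(\mathbb N, +)$ of non-negative integers (so $0 \in S$) such that $\mathbb N \setminus S$ is finite. For a numerical monoid $S$, the reduced finitary power monoid $\mathcal P_{\mathrm{fin},0}(S)$ is the monoid whose elements are the finite subsets of $S$ containing $0$, with operation the set addition $X + Y := \{x + y : x \in X,\ y \in Y\}$ and identity $\{0\}$. Isomorphisms are monoid isomorphisms. *)

theory Defs
  imports "HOL-Algebra.Group" "HOL-Library.Set_Algebras"
begin

definition nat_add_monoid :: "nat monoid"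
  where "nat_add_monoid = \<lparr>carrier = UNIV, mult = (+), one = 0\<rparr>"

definition numerical_monoid :: "nat set \<Rightarrow> bool"
  where "numerical_monoid S \<longleftrightarrow> submonoid S nat_add_monoid \<and> finite (UNIV - S)"

(* On sets, + is the set addition X + Y = {x + y | x y. x \<in> X \<and> y \<in> Y} of
   HOL-Library.Set_Algebras. *)
definition reduced_power_monoid :: "nat set \<Rightarrow> nat set monoid"
  where "reduced_power_monoid S =
    \<lparr>carrier = {X. X \<subseteq> S \<and> finite X \<and> 0 \<in> X}, mult = (+), one = {0}\<rparr>"

lemma nat_add_monoid_is_monoid: "monoid nat_add_monoid"
  by unfold_locales (auto simp: nat_add_monoid_def)

lemma numerical_monoid_iff:
  "numerical_monoid S \<longleftrightarrow>
    0 \<in> S \<and> (\<forall>x\<in>S. \<forall>y\<in>S. x + y \<in> S) \<and> finite (UNIV - S)"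
  by (auto simp: numerical_monoid_def submonoid_def nat_add_monoid_def)

lemma reduced_power_monoid_is_monoid:
  assumes "numerical_monoid S"
  shows "monoid (reduced_power_monoid S)"
proof
  fix X Y
  assume "X \<in> carrier (reduced_power_monoid S)" "Y \<in> carrier (reduced_power_monoid S)"
  then show "X \<otimes>\<^bsub>reduced_power_monoid S\<^esub> Y \<in> carrier (reduced_power_monoid S)"
    using assms
    by (auto simp: reduced_power_monoid_def numerical_monoid_iff finite_set_plus
        elim!: set_plus_elim intro: set_plus_intro[of "0::nat" _ 0, simplified])
qed (use assms in \<open>auto simp: reduced_power_monoid_def numerical_monoid_iff add.assoc
        add_0_left[where 'a = "nat set", unfolded set_zero]
        add_0_right[where 'a = "nat set", unfolded set_zero]\<close>)

(* Elements of hom are only required to preserve the multiplication. A bijective one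
   automatically maps the identity to the identity, so \<cong> is isomorphism of monoids. *)
lemma iso_reduced_power_monoid_one:
  assumes "numerical_monoid S" "numerical_monoid T"
    and h: "h \<in> iso (reduced_power_monoid S) (reduced_power_monoid T)"
  shows "h \<one>\<^bsub>reduced_power_monoid S\<^esub> = \<one>\<^bsub>reduced_power_monoid T\<^esub>"
proof -
  interpret S: monoid "reduced_power_monoid S"
    by (rule reduced_power_monoid_is_monoid) fact
  interpret T: monoid "reduced_power_monoid T"
    by (rule reduced_power_monoid_is_monoid) fact
  have bij: "bij_betw h (carrier (reduced_power_monoid S)) (carrier (reduced_power_monoid T))"
    and hom: "h \<in> hom (reduced_power_monoid S) (reduced_power_monoid T)"
    using h by (auto simp: iso_def)
  obtain x where x: "x \<in> carrier (reduced_power_monoid S)"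
    and hx: "h x = \<one>\<^bsub>reduced_power_monoid T\<^esub>"
    using bij T.one_closed by (metis bij_betw_imp_surj_on imageE)
  have "h \<one>\<^bsub>reduced_power_monoid S\<^esub>
      = h \<one>\<^bsub>reduced_power_monoid S\<^esub> \<otimes>\<^bsub>reduced_power_monoid T\<^esub> h x"
    using hom by (simp add: hx hom_in_carrier)
  also have "\<dots> = h (\<one>\<^bsub>reduced_power_monoid S\<^esub> \<otimes>\<^bsub>reduced_power_monoid S\<^esub> x)"
    using hom_mult[OF hom S.one_closed x] by simp
  also have "\<dots> = \<one>\<^bsub>reduced_power_monoid T\<^esub>"
    using x hx by simp
  finally show ?thesis .
qed

end

theory Submission
  imports Defs
begin

text \<open>
  The invariant that survives an isomorphism is the maximum. Write \<open>k A\<close> for the sum of \<open>k\<close> copies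
  of a finite set \<open>A\<close> containing \<open>0\<close>, and let \<open>a = Max A\<close>. For large \<open>k\<close> one has
  \<open>(k + 1) A = k A + {0, a}\<close> (lemma \<open>sumset_Suc_eq_endpoints\<close>). Apply a homomorphism \<open>h\<close> of reduced
  power monoids and compare maxima: since \<open>Max\<close> is additive, \<open>Max (h A) = Max (h {0, a})\<close>, so the
  maximum of \<open>h A\<close> depends on the maximum of \<open>A\<close> only. Thus \<open>h\<close> induces a map
  \<open>\<phi> a = Max (h {0, a})\<close> between the underlying numerical monoids, and
  \<open>Max (h A) = \<phi> (Max A)\<close> for all \<open>A\<close>.

  Evaluating this on \<open>b {0, a}\<close>, whose maximum is \<open>a b\<close>, gives \<open>\<phi> (a b) = b \<phi> a\<close>. By symmetry
  \<open>b \<phi> a = a \<phi> b\<close> for all \<open>a\<close> and \<open>b\<close> in the source, so \<open>\<phi>\<close> is multiplication by a constant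
  \<open>c\<close>, an integer because the source contains consecutive numbers. If \<open>h\<close> is onto, then so
  is \<open>\<phi>\<close>, and the target is the set of \<open>c\<close>-fold multiples of the source. The target contains
  consecutive numbers as well, which forces \<open>c = 1\<close>.
\<close>

section \<open>Iterated sumsets\<close>

primrec sumset :: "nat \<Rightarrow> nat set \<Rightarrow> nat set" where
  "sumset 0 A = {0}"
| "sumset (Suc k) A = A + sumset k A"

lemma sum_list_in_sumset: "set xs \<subseteq> A \<Longrightarrow> sum_list xs \<in> sumset (length xs) A"
  by (induction xs) (auto intro: set_plus_intro)

lemma in_sumsetE:
  assumes "x \<in> sumset k A"
  obtains xs where "length xs = k" "set xs \<subseteq> A" "x = sum_list xs"
proof -
  have "\<exists>xs. length xs = k \<and> set xs \<subseteq> A \<and> x = sum_list xs"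
    using assms
  proof (induction k arbitrary: x)
    case (Suc k)
    then obtain y z where yz: "x = y + z" "y \<in> A" "z \<in> sumset k A"
      by (auto elim: set_plus_elim)
    then obtain xs where "length xs = k" "set xs \<subseteq> A" "z = sum_list xs"
      using Suc.IH by blast
    then show ?case
      using yz by (intro exI[of _ "y # xs"]) simp
  qed simp
  then show ?thesis using that by blast
qed

lemma finite_sumset: "finite A \<Longrightarrow> finite (sumset k A)"
  by (induction k) (auto intro: finite_set_plus)

lemma zero_in_sumset: "0 \<in> A \<Longrightarrow> 0 \<in> sumset k A"
  by (induction k) (use set_plus_intro[of 0 A 0] in auto)

lemma sumset_mono:
  assumes "0 \<in> A" "k \<le> l"
  shows "sumset k A \<subseteq> sumset l A"
  using assms(2)
proof (induction rule: dec_induct)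
  case (step n)
  then show ?case using set_zero_plus2[OF assms(1), of "sumset n A"] by auto
qed simp

lemma Max_set_plus:
  fixes A B :: "nat set"
  assumes "finite A" "A \<noteq> {}" "finite B" "B \<noteq> {}"
  shows "Max (A + B) = Max A + Max B"
proof (rule Max_eqI)
  show "Max A + Max B \<in> A + B"
    using assms by (intro set_plus_intro Max_in)
  show "y \<le> Max A + Max B" if "y \<in> A + B" for y
    using that assms by (auto elim!: set_plus_elim intro!: add_mono)
qed (use assms in \<open>auto intro: finite_set_plus\<close>)

lemma Max_sumset:
  assumes "finite A" "0 \<in> A"
  shows "Max (sumset k A) = k * Max A"
proof (induction k)
  case (Suc k)
  have "Max (sumset (Suc k) A) = Max A + Max (sumset k A)"
    using assms finite_sumset zero_in_sumset unfolding sumset.simps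
    by (intro Max_set_plus) blast+
  then show ?case using Suc by simp
qed simp

section \<open>Large multiples are generated by the endpoints\<close>

text \<open>Among the \<open>a + 1\<close> sums of the first \<open>0, \<dots>, a\<close> entries two agree modulo \<open>a\<close>; the block between
  them is the one wanted.\<close>

lemma zero_sum_block:
  fixes xs :: "nat list"
  assumes "0 < a" "a \<le> length xs"
  obtains us vs ws where "xs = us @ vs @ ws" "vs \<noteq> []" "a dvd sum_list vs"
proof -
  define s where "s i = sum_list (take i xs) mod a" for i
  have "s ` {..a} \<subseteq> {..<a}"
    using assms by (auto simp: s_def)
  then have "card (s ` {..a}) < card {..a}"
    using card_mono[of "{..<a}" "s ` {..a}"] by simp
  then have "\<not> inj_on s {..a}"
    by (rule pigeonhole)
  then obtain i j where ij: "i < j" "j \<le> a" "s i = s j"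
    by (metis atMost_iff inj_onI linorder_neqE_nat)
  define vs where "vs = drop i (take j xs)"
  have "take j xs = take i xs @ vs"
    using ij by (metis append_take_drop_id less_imp_le min.absorb1 take_take vs_def)
  then have "xs = take i xs @ vs @ drop j xs"
    and "sum_list (take j xs) = sum_list (take i xs) + sum_list vs"
    by (metis append_assoc append_take_drop_id, simp)
  moreover have "vs \<noteq> []"
    using ij assms by (simp add: vs_def)
  ultimately show ?thesis
    using that ij(3) mod_eq_dvd_iff_nat[of "sum_list (take i xs)" "sum_list (take j xs)" a]
    by (simp add: s_def)
qed

text \<open>If a summand is \<open>0\<close> or the maximum \<open>a\<close>, split it off. Otherwise all summands lie strictly
  between \<open>0\<close> and \<open>a\<close>, and since there are at least \<open>a\<close> of them some block of \<open>l\<close> consecutive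
  summands adds up to \<open>m a\<close>. Each summand is below \<open>a\<close>, so \<open>m < l\<close>, and trading the block for
  \<open>m\<close> copies of \<open>a\<close> saves a summand; padding with zeros then gives a sum of \<open>k\<close> elements.\<close>

lemma sumset_Suc_eq_endpoints:
  assumes A: "finite A" "0 \<in> A" and k: "Max A \<le> k"
  shows "sumset (Suc k) A = sumset k A + {0, Max A}"
proof
  define a where "a = Max A"
  have a: "a \<in> A" "\<And>x. x \<in> A \<Longrightarrow> x \<le> a"
    using A by (auto simp: a_def intro: Max_in)
  show "sumset k A + {0, Max A} \<subseteq> sumset (Suc k) A"
    using A(2) a(1)
    unfolding sumset.simps add.commute[of A] a_def by (intro set_plus_mono2) auto
  show "sumset (Suc k) A \<subseteq> sumset k A + {0, Max A}"
  proof
    fix x assume "x \<in> sumset (Suc k) A"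
    then obtain xs where xs: "length xs = Suc k" "set xs \<subseteq> A" "x = sum_list xs"
      by (rule in_sumsetE)
    show "x \<in> sumset k A + {0, Max A}"
    proof (cases "set xs \<inter> {0, a} = {}")
      case False
      then obtain y where y: "y \<in> set xs" "y \<in> {0, a}" by blast
      have "sum_list (remove1 y xs) \<in> sumset k A"
        using sum_list_in_sumset[of "remove1 y xs" A] xs y set_remove1_subset[of y xs]
        by (auto simp: length_remove1)
      moreover have "x = sum_list (remove1 y xs) + y"
        using xs by (simp add: sum_list_map_remove1[OF y(1), of id, simplified])
      ultimately show ?thesis
        using y by (auto simp: a_def intro: set_plus_intro)
    next
      case True
      have small: "y < a" if "y \<in> set xs" for y
        using True that a(2)[of y] xs(2) by (auto simp: order_less_le)
      have "xs \<noteq> []" using xs(1) by auto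
      then have "0 < a" using small[of "hd xs"] by auto
      then obtain us vs ws
        where split: "xs = us @ vs @ ws" "vs \<noteq> []" "a dvd sum_list vs"
        using zero_sum_block[of a xs] xs(1) k by (auto simp: a_def)
      then obtain m where m: "sum_list vs = a * m" by (auto elim: dvdE)
      have "sum_list vs < length vs * a"
      proof -
        have "sum_list ys < length ys * a" if "ys \<noteq> []" "set ys \<subseteq> set vs" for ys
          using that
        proof (induction ys rule: list_nonempty_induct)
          case (single y)
          then show ?case using small split(1) by auto
        next
          case (cons y ys)
          then show ?case using small[of y] split(1) by auto
        qed
        then show ?thesis using split(2) by blast
      qed
      then have "m < length vs"
        using m by (simp add: mult.commute)
      define zs where "zs = us @ replicate m a @ ws"
      have "length zs \<le> k"
        using xs(1) split(1) \<open>m < length vs\<close> by (simp add: zs_def)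
      moreover have "x = sum_list zs"
        using xs(3) split(1) m by (simp add: zs_def sum_list_replicate)
      moreover have "set zs \<subseteq> A"
        using xs(2) split(1) a(1) by (auto simp: zs_def)
      ultimately have "x \<in> sumset k A"
        using sum_list_in_sumset sumset_mono[OF A(2)] by blast
      then show ?thesis
        using set_plus_intro[of x "sumset k A" 0 "{0, Max A}"] by simp
    qed
  qed
qed

section \<open>Homomorphisms of reduced power monoids\<close>

lemma reduced_power_monoid_simps:
  "X \<in> carrier (reduced_power_monoid S) \<longleftrightarrow> X \<subseteq> S \<and> finite X \<and> 0 \<in> X"
  "X \<otimes>\<^bsub>reduced_power_monoid S\<^esub> Y = X + Y"
  by (auto simp: reduced_power_monoid_def)

lemma set_plus_in_reduced_power_monoid:
  assumes "numerical_monoid S"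
    and "X \<in> carrier (reduced_power_monoid S)" "Y \<in> carrier (reduced_power_monoid S)"
  shows "X + Y \<in> carrier (reduced_power_monoid S)"
  using monoid.m_closed[OF reduced_power_monoid_is_monoid[OF assms(1)] assms(2,3)]
  by (simp add: reduced_power_monoid_simps(2))

lemma sumset_in_reduced_power_monoid:
  assumes S: "numerical_monoid S" and A: "A \<in> carrier (reduced_power_monoid S)"
  shows "sumset k A \<in> carrier (reduced_power_monoid S)"
proof (induction k)
  case 0
  then show ?case using S by (simp add: reduced_power_monoid_simps numerical_monoid_iff)
next
  case (Suc k)
  then show ?case using set_plus_in_reduced_power_monoid[OF S A] by simp
qed

lemma pair_in_reduced_power_monoid:
  "numerical_monoid S \<Longrightarrow> a \<in> S \<Longrightarrow> {0, a} \<in> carrier (reduced_power_monoid S)"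
  by (simp add: reduced_power_monoid_simps numerical_monoid_iff)

lemma Max_in_numerical_monoid:
  "A \<in> carrier (reduced_power_monoid S) \<Longrightarrow> Max A \<in> S"
  by (metis Max_in empty_iff reduced_power_monoid_simps(1) subsetD)

lemma numerical_monoid_cofinal:
  assumes "numerical_monoid S"
  shows "\<exists>N. \<forall>n\<ge>N. n \<in> S"
proof -
  obtain N where "\<forall>n\<in>UNIV - S. n < N"
    using assms by (auto simp: numerical_monoid_iff finite_nat_set_iff_bounded)
  then show ?thesis by (metis DiffI UNIV_I leD)
qed

context
  fixes S T :: "nat set" and h :: "nat set \<Rightarrow> nat set"
  assumes S: "numerical_monoid S" and T: "numerical_monoid T"
    and h: "h \<in> hom (reduced_power_monoid S) (reduced_power_monoid T)"
begin

lemma hom_in_reduced_power_monoid: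
  "A \<in> carrier (reduced_power_monoid S) \<Longrightarrow> h A \<in> carrier (reduced_power_monoid T)"
  using h by (rule hom_in_carrier)

lemma hom_finite: "A \<in> carrier (reduced_power_monoid S) \<Longrightarrow> finite (h A)"
  and hom_zero_in: "A \<in> carrier (reduced_power_monoid S) \<Longrightarrow> 0 \<in> h A"
  using hom_in_reduced_power_monoid by (auto simp: reduced_power_monoid_simps)

lemma hom_set_plus:
  "A \<in> carrier (reduced_power_monoid S) \<Longrightarrow> B \<in> carrier (reduced_power_monoid S)
    \<Longrightarrow> h (A + B) = h A + h B"
  using hom_mult[OF h] by (simp add: reduced_power_monoid_simps(2))

lemma Max_hom_set_plus:
  assumes "A \<in> carrier (reduced_power_monoid S)" "B \<in> carrier (reduced_power_monoid S)"
  shows "Max (h (A + B)) = Max (h A) + Max (h B)"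
  unfolding hom_set_plus[OF assms] using assms hom_finite hom_zero_in by (intro Max_set_plus) blast+

text \<open>The base case holds because \<open>{0} + {0} = {0}\<close> makes \<open>Max (h {0})\<close> its own double.\<close>

lemma Max_hom_sumset:
  assumes A: "A \<in> carrier (reduced_power_monoid S)"
  shows "Max (h (sumset k A)) = k * Max (h A)"
proof (induction k)
  case 0
  have "{0} \<in> carrier (reduced_power_monoid S)"
    using S by (simp add: reduced_power_monoid_simps numerical_monoid_iff)
  then have "Max (h ({0} + {0})) = Max (h {0}) + Max (h {0})"
    by (intro Max_hom_set_plus)
  then show ?case by (simp add: set_plus_def)
next
  case (Suc k)
  then show ?case
    using Max_hom_set_plus[OF A sumset_in_reduced_power_monoid[OF S A]] by simp
qed

text \<open>Apply \<open>h\<close> to \<open>(k + 1) A = k A + {0, Max A}\<close>, take maxima and cancel \<open>k * Max (h A)\<close>.\<close>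

lemma Max_hom_eq_Max_hom_pair:
  assumes A: "A \<in> carrier (reduced_power_monoid S)"
  shows "Max (h A) = Max (h {0, Max A})"
proof -
  define k where "k = Max A"
  have "sumset (Suc k) A = sumset k A + {0, Max A}"
    using A by (intro sumset_Suc_eq_endpoints) (auto simp: reduced_power_monoid_simps k_def)
  then have "Suc k * Max (h A) = Max (h (sumset k A + {0, Max A}))"
    using Max_hom_sumset[OF A, of "Suc k"] by simp
  also have "\<dots> = k * Max (h A) + Max (h {0, Max A})"
    using Max_hom_set_plus[OF sumset_in_reduced_power_monoid[OF S A]
        pair_in_reduced_power_monoid[OF S Max_in_numerical_monoid[OF A]]]
    by (simp add: Max_hom_sumset[OF A])
  finally show ?thesis by simp
qed

lemma Max_hom_pair_mult:
  assumes "a \<in> S"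
  shows "Max (h {0, a * b}) = b * Max (h {0, a})"
proof -
  have A: "{0, a} \<in> carrier (reduced_power_monoid S)"
    using S assms by (rule pair_in_reduced_power_monoid)
  have "Max (h {0, Max (sumset b {0, a})}) = b * Max (h {0, a})"
    using Max_hom_eq_Max_hom_pair[OF sumset_in_reduced_power_monoid[OF S A]]
      Max_hom_sumset[OF A] by metis
  then show ?thesis by (simp add: Max_sumset mult.commute)
qed

text \<open>For \<open>n\<close> and \<open>n + 1\<close> in \<open>S\<close> the relation \<open>(n + 1) \<phi> n = n \<phi> (n + 1)\<close> shows that \<open>n\<close>
  divides \<open>\<phi> n\<close>, so the proportionality constant is an integer.\<close>

lemma Max_hom_proportional:
  obtains c where "\<And>A. A \<in> carrier (reduced_power_monoid S) \<Longrightarrow> Max (h A) = c * Max A"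
proof -
  define \<phi> where "\<phi> a = Max (h {0, a})" for a
  have swap: "b * \<phi> a = a * \<phi> b" if "a \<in> S" "b \<in> S" for a b
    using Max_hom_pair_mult[OF that(1), of b] Max_hom_pair_mult[OF that(2), of a]
    by (simp add: \<phi>_def mult.commute)
  obtain N where N: "\<And>n. N \<le> n \<Longrightarrow> n \<in> S"
    using numerical_monoid_cofinal[OF S] by blast
  define n where "n = Suc N"
  have n: "n \<in> S" "Suc n \<in> S" "0 < n"
    using N by (auto simp: n_def)
  have "n * \<phi> (Suc n) = n * \<phi> n + \<phi> n"
    using swap[OF n(1,2)] by simp
  then have "n dvd \<phi> n"
    by (metis dvd_add_right_iff dvd_triv_left)
  then obtain c where c: "\<phi> n = n * c" by (auto elim: dvdE)
  have "\<phi> a = c * a" if "a \<in> S" for a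
    using swap[OF n(1) that] n(3) c by (simp add: mult.commute mult.left_commute)
  then show ?thesis
    using that Max_hom_eq_Max_hom_pair Max_in_numerical_monoid unfolding \<phi>_def by metis
qed

text \<open>Every \<open>y\<close> in \<open>T\<close> is the maximum of the image \<open>{0, y}\<close> of some \<open>A\<close>, hence \<open>c\<close> times
  an element of \<open>S\<close>. So \<open>T\<close> consists of multiples of \<open>c\<close>; being cofinite, it rules out every
  \<open>c\<close> other than \<open>1\<close>.\<close>

lemma surjective_hom_imp_eq:
  assumes surj: "h ` carrier (reduced_power_monoid S) = carrier (reduced_power_monoid T)"
  shows "S = T"
proof -
  obtain c where c: "\<And>A. A \<in> carrier (reduced_power_monoid S) \<Longrightarrow> Max (h A) = c * Max A"
    using Max_hom_proportional by blast
  have T_eq: "T = (*) c ` S"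
  proof
    show "T \<subseteq> (*) c ` S"
    proof
      fix y assume "y \<in> T"
      then have "{0, y} \<in> h ` carrier (reduced_power_monoid S)"
        using pair_in_reduced_power_monoid[OF T] surj by simp
      then obtain A where A: "A \<in> carrier (reduced_power_monoid S)" "h A = {0, y}"
        by auto
      then show "y \<in> (*) c ` S"
        using c[OF A(1)] Max_in_numerical_monoid[OF A(1)] by auto
    qed
    show "(*) c ` S \<subseteq> T"
    proof clarify
      fix x assume "x \<in> S"
      then have A: "{0, x} \<in> carrier (reduced_power_monoid S)"
        by (rule pair_in_reduced_power_monoid[OF S])
      show "c * x \<in> T"
        using c[OF A] Max_in_numerical_monoid[OF hom_in_reduced_power_monoid[OF A]] by simp
    qed
  qed
  obtain N where N: "\<And>n. N \<le> n \<Longrightarrow> n \<in> T"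
    using numerical_monoid_cofinal[OF T] by blast
  have "c dvd N" "c dvd Suc N"
    using N[of N] N[of "Suc N"] by (auto simp: T_eq)
  then have "c = 1"
    by (metis Suc_eq_plus1 dvd_add_right_iff nat_dvd_1_iff_1)
  then show ?thesis
    by (simp add: T_eq)
qed

end

theorem corollary2p6:
  fixes S\<^sub>1 S\<^sub>2 :: "nat set"
  assumes "numerical_monoid S\<^sub>1" and "numerical_monoid S\<^sub>2"
  shows "reduced_power_monoid S\<^sub>1 \<cong> reduced_power_monoid S\<^sub>2 \<longleftrightarrow> S\<^sub>1 = S\<^sub>2"
proof
  assume "reduced_power_monoid S\<^sub>1 \<cong> reduced_power_monoid S\<^sub>2"
  then obtain h where "h \<in> iso (reduced_power_monoid S\<^sub>1) (reduced_power_monoid S\<^sub>2)"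
    by (auto simp: is_iso_def)
  then show "S\<^sub>1 = S\<^sub>2"
    by (intro surjective_hom_imp_eq[OF assms]) (auto simp: iso_def bij_betw_def)
next
  assume "S\<^sub>1 = S\<^sub>2"
  then show "reduced_power_monoid S\<^sub>1 \<cong> reduced_power_monoid S\<^sub>2"
    by (auto simp: is_iso_def intro: iso_set_refl)
qed

end
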